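(* There exist a strictly convex $C^1$ (continuously differentiable) function $F:[0,1]\to\mathbb{R}$ and a set $E$ of lines in $\mathbb{R}^2$ such that $\operatorname{graph}(F)\subset\bigcup E$, every line of $E$ intersects $\operatorname{graph}(F)$ in a single point, and $\dim\left(\bigcup E\right)=1$.
   Context: $\dim$ denotes Hausdorff dimension, and $\operatorname{graph}(F)=\{(x,F(x)) : x\in[0,1]\}\subset\mathbb{R}^2$. Lines are full straight lines in the plane; vertical lines are allowed. $\bigcup E$ is the union of all lines belonging to $E$. *)

theory Defs
  imports "HOL-Analysis.Analysis"
begin

(* The case distinction fixes the conventions 0^0 = 1 for nonempty sets of diameter 0 and
   (diam {})^s = 0; powr has 0 powr 0 = 0. *)
definition diam_powr :: "real \<Rightarrow> 'a::metric_space set \<Rightarrow> ennreal" where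
  "diam_powr s U =
     (if U = {} then 0 else if s = 0 then 1 else ennreal (diameter U powr s))"

(* Boundedness is required explicitly because diameter is unspecified on unbounded sets.
   Finite covers are included, since members of the sequence may be empty. *)
definition hausdorff_premeasure :: "real \<Rightarrow> real \<Rightarrow> 'a::metric_space set \<Rightarrow> ennreal" where
  "hausdorff_premeasure s \<delta> A =
     (INF U \<in> {U :: nat \<Rightarrow> 'a set.
                 A \<subseteq> (\<Union>i. U i) \<and> (\<forall>i. bounded (U i) \<and> diameter (U i) \<le> \<delta>)}.
        \<Sum>i. diam_powr s (U i))"

(* Not normalised to agree with Lebesgue measure; this does not affect the dimension. *)
definition hausdorff_measure :: "real \<Rightarrow> 'a::metric_space set \<Rightarrow> ennreal" where
  "hausdorff_measure s A = (SUP \<delta> \<in> {0<..}. hausdorff_premeasure s \<delta> A)"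

definition hausdorff_dim :: "'a::metric_space set \<Rightarrow> ennreal" where
  "hausdorff_dim A = (INF s \<in> {s. 0 \<le> s \<and> hausdorff_measure s A = 0}. ennreal s)"

definition strictly_convex_on :: "'a::real_vector set \<Rightarrow> ('a \<Rightarrow> real) \<Rightarrow> bool" where
  "strictly_convex_on S f \<longleftrightarrow> convex S \<and>
     (\<forall>x\<in>S. \<forall>y\<in>S. \<forall>t\<in>{0<..<1}. x \<noteq> y \<longrightarrow>
        f ((1 - t) *\<^sub>R x + t *\<^sub>R y) < (1 - t) * f x + t * f y)"

(* Derivatives are taken within S, hence one-sided at the endpoints of an interval.  The
   library's C1_differentiable_on uses two-sided derivatives, which would also depend on the
   values of f outside S. *)
definition C1_on :: "real set \<Rightarrow> (real \<Rightarrow> real) \<Rightarrow> bool" where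
  "C1_on S f \<longleftrightarrow>
     (\<exists>f'. (\<forall>x\<in>S. (f has_real_derivative f' x) (at x within S)) \<and> continuous_on S f')"

definition graph_on :: "'a set \<Rightarrow> ('a \<Rightarrow> 'b) \<Rightarrow> ('a \<times> 'b) set" where
  "graph_on S f = (\<lambda>x. (x, f x)) ` S"

(* The metric on real \<times> real is the Euclidean one. *)
definition is_line :: "(real \<times> real) set \<Rightarrow> bool" where
  "is_line L \<longleftrightarrow> affine L \<and> aff_dim L = 1"

end

theory Submission
  imports Defs
begin

text \<open>A transversal family of lines of dimension \<open>0\<close> meets a smooth graph in a set of dimension \<open>0\<close>, so most
  points of the graph have to be covered by tangents. All tangents together would sweep out a set with
  interior, because the slopes of the tangents of a strictly convex \<open>C\<^sup>1\<close> function fill an interval.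
  The way out is a derivative \<open>g\<close> that is extremely singular: there is a set \<open>V\<close> of dimension \<open>0\<close> such
  that \<open>g\<close> maps the rest of \<open>{0..1}\<close> onto a set of dimension \<open>0\<close>. The lines are then the vertical lines
  over \<open>V\<close> and the tangents at the points outside \<open>V\<close>; strict convexity makes a tangent meet the graph
  only once. Vertical lines depend in a Lipschitz way on their abscissa, and the tangents, over a bounded
  range, on their slope (\<open>tangent_lines_close\<close>); so both families have dimension \<open>0\<close>, in a sense strong
  enough to give a union of dimension \<open>1\<close>.

  Such a \<open>g\<close> is generic among the nondecreasing functions on \<open>{0..1}\<close>. At scale \<open>n\<close> every point is
  required to be very close to a finite set \<open>P n\<close> or to be mapped very close to a finite set \<open>S n\<close>. This
  condition is open, and it is dense because composing with a steep staircase achieves it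
  (\<open>finely_split_dense\<close>); Baire's theorem gives all scales at once
  (\<open>exists_finely_split_slope\<close>). For \<open>V\<close> take the points that are close to \<open>P n\<close> for infinitely many \<open>n\<close>.
  Outside \<open>V\<close> the value of \<open>g\<close> is close to \<open>S n\<close> for all large \<open>n\<close>.

  Consequently every point of the union lies, for infinitely many \<open>n\<close>, in one of finitely many thin
  tubes about segments of length of order \<open>n\<close>. A tube of radius \<open>r\<close> needs about \<open>n / r\<close> balls of radius of
  order \<open>r\<close>, so for \<open>s > 1\<close> its \<open>s\<close>-cost is small with \<open>r\<close>. Since \<open>r\<close> may be chosen after the number of
  tubes is known, the total cost at scale \<open>n\<close> is at most \<open>(1/2) ^ n\<close> for all large \<open>n\<close>, and a
  Borel--Cantelli argument shows that the union is a null set in every dimension \<open>s > 1\<close>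
  (\<open>hausdorff_measure_tubes_eq_0\<close>). The dimension is at least \<open>1\<close> because the union contains a line.\<close>

section \<open>Hausdorff measure of limsup sets and of lines\<close>

text \<open>The covers of a limsup set are the tails of the given sequence of finite families. Row \<open>n\<close>
  contributes at most \<open>(1/2) ^ n\<close>, so the tail from \<open>n0\<close> on costs at most \<open>2 * (1/2) ^ n0\<close>; the double
  family is enumerated by the pairing function.\<close>

lemma limsup_cover_premeasure:
  fixes C :: "nat \<Rightarrow> nat \<Rightarrow> 'a::metric_space set"
  assumes s: "0 < s" and \<delta>: "0 < \<delta>"
    and bdd: "\<And>n i. bounded (C n i)" and diam: "\<And>n i. n0 \<le> n \<Longrightarrow> diameter (C n i) \<le> \<delta>"
    and fin: "\<And>n i. n0 \<le> n \<Longrightarrow> K n \<le> i \<Longrightarrow> C n i = {}"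
    and sum: "\<And>n. n0 \<le> n \<Longrightarrow> (\<Sum>i<K n. diameter (C n i) powr s) \<le> (1/2) ^ n"
    and A: "\<And>z. z \<in> A \<Longrightarrow> \<exists>n\<ge>n0. \<exists>i. z \<in> C n i"
  shows "hausdorff_premeasure s \<delta> A \<le> ennreal (2 * (1/2) ^ n0)"
proof -
  define D where "D = (\<lambda>(n, i). C (n + n0) i)"
  define U where "U k = D (prod_decode k)" for k
  have row: "(\<Sum>i. diam_powr s (D (n, i))) \<le> ennreal ((1/2) ^ (n + n0))" for n
  proof -
    have "(\<Sum>i. diam_powr s (D (n, i))) = (\<Sum>i<K (n + n0). diam_powr s (D (n, i)))"
      by (rule suminf_finite) (auto simp: D_def diam_powr_def fin)
    also have "\<dots> \<le> (\<Sum>i<K (n + n0). ennreal (diameter (C (n + n0) i) powr s))"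
      using s by (intro sum_mono) (auto simp: D_def diam_powr_def)
    also have "\<dots> = ennreal (\<Sum>i<K (n + n0). diameter (C (n + n0) i) powr s)"
      by simp
    also have "\<dots> \<le> ennreal ((1/2) ^ (n + n0))"
      by (intro ennreal_leI sum) simp
    finally show ?thesis .
  qed
  have "A \<subseteq> (\<Union>k. U k)"
  proof
    fix z assume "z \<in> A"
    then obtain n i where "n0 \<le> n" "z \<in> C n i" using A by blast
    then have "z \<in> U (prod_encode (n - n0, i))" by (simp add: U_def D_def)
    then show "z \<in> (\<Union>k. U k)" by blast
  qed
  moreover have "bounded (U k) \<and> diameter (U k) \<le> \<delta>" for k
    using bdd diam by (auto simp: U_def D_def split: prod.split)
  ultimately have "hausdorff_premeasure s \<delta> A \<le> (\<Sum>k. diam_powr s (U k))"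
    unfolding hausdorff_premeasure_def by (intro INF_lower) auto
  also have "\<dots> = (\<Sum>n. \<Sum>i. diam_powr s (D (n, i)))"
    unfolding U_def by (rule suminf_ennreal_2dimen) simp
  also have "\<dots> \<le> (\<Sum>n. ennreal ((1/2) ^ (n + n0)))"
    by (intro suminf_le row) auto
  also have "\<dots> = ennreal (\<Sum>n. (1/2) ^ (n + n0))"
    by (intro suminf_ennreal2) (auto simp: power_add intro!: summable_mult2)
  also have "(\<Sum>n. (1/2::real) ^ (n + n0)) = 2 * (1/2) ^ n0"
    by (simp add: power_add suminf_mult2[symmetric] suminf_geometric)
  finally show ?thesis .
qed

text \<open>A Borel--Cantelli lemma for Hausdorff measures: points that are covered infinitely often by
  families of summable \<open>s\<close>-cost form a null set, because every tail of the families covers them.\<close>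

lemma hausdorff_measure_limsup_eq_0:
  fixes C :: "nat \<Rightarrow> nat \<Rightarrow> 'a::metric_space set"
  assumes s: "0 < s"
    and bdd: "\<And>n i. bounded (C n i)"
    and fin: "\<And>n i. K n \<le> i \<Longrightarrow> C n i = {}"
    and diam: "\<And>n i. diameter (C n i) \<le> d n" "d \<longlonglongrightarrow> 0"
    and sum: "\<forall>\<^sub>F n in sequentially. (\<Sum>i<K n. diameter (C n i) powr s) \<le> (1/2) ^ n"
    and A: "\<And>z. z \<in> A \<Longrightarrow> \<exists>\<^sub>F n in sequentially. \<exists>i. z \<in> C n i"
  shows "hausdorff_measure s A = 0"
proof -
  have "hausdorff_premeasure s \<delta> A = 0" if \<delta>: "0 < \<delta>" for \<delta>
  proof -
    have "\<forall>\<^sub>F n in sequentially. d n < \<delta>"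
      using diam(2) \<delta> by (rule order_tendstoD)
    then have "\<forall>\<^sub>F n in sequentially. d n < \<delta> \<and> (\<Sum>i<K n. diameter (C n i) powr s) \<le> (1/2) ^ n"
      using sum by eventually_elim simp
    then obtain N where N: "\<And>n. N \<le> n \<Longrightarrow> d n < \<delta>"
      "\<And>n. N \<le> n \<Longrightarrow> (\<Sum>i<K n. diameter (C n i) powr s) \<le> (1/2) ^ n"
      unfolding eventually_sequentially by blast
    have "hausdorff_premeasure s \<delta> A \<le> ennreal (2 * (1/2) ^ n0)" if n0: "N \<le> n0" for n0
    proof (rule limsup_cover_premeasure[OF s \<delta> bdd])
      show "diameter (C n i) \<le> \<delta>" if "n0 \<le> n" for n i
        using diam(1)[of n i] N(1)[of n] that n0 by linarith
      show "\<exists>n\<ge>n0. \<exists>i. z \<in> C n i" if "z \<in> A" for z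
        using A[OF that] unfolding frequently_sequentially by blast
    qed (use n0 fin N(2) in auto)
    moreover have "(\<lambda>n. ennreal (2 * (1/2) ^ n)) \<longlonglongrightarrow> ennreal 0"
      by (intro tendsto_ennrealI tendsto_mult_right_zero LIMSEQ_power_zero) simp
    ultimately have "hausdorff_premeasure s \<delta> A \<le> 0"
      by (intro LIMSEQ_le_const) auto
    then show ?thesis by simp
  qed
  then show ?thesis
    by (simp add: hausdorff_measure_def)
qed

text \<open>The lower bound is Lebesgue measure in disguise. A cover of the line pulls back to a cover of
  the parameter interval \<open>{0..1}\<close>, where a set of diameter \<open>d\<close> lies in an interval of length \<open>2 * d\<close>; and
  \<open>d \<le> d powr s\<close> for \<open>d \<le> 1\<close> and \<open>s \<le> 1\<close>.\<close>

lemma hausdorff_premeasure_line_ge: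
  fixes a v :: "'a::euclidean_space"
  assumes s: "0 \<le> s" "s \<le> 1" and v: "1 \<le> norm v" and A: "range (\<lambda>t. a + t *\<^sub>R v) \<subseteq> A"
  shows "ennreal (1/2) \<le> hausdorff_premeasure s 1 A"
  unfolding hausdorff_premeasure_def
proof (rule INF_greatest, clarify)
  fix U :: "nat \<Rightarrow> 'a set"
  assume cover: "A \<subseteq> (\<Union>i. U i)" and U: "\<forall>i. bounded (U i) \<and> diameter (U i) \<le> 1"
  define T where "T i = {t. a + t *\<^sub>R v \<in> U i}" for i
  define I where "I i = (if T i = {} then {} else cball (SOME t. t \<in> T i) (diameter (U i)))" for i
  have "T i \<subseteq> I i" for i
  proof
    fix t assume t: "t \<in> T i"
    define u where "u = (SOME t. t \<in> T i)"
    have u: "u \<in> T i" unfolding u_def using t by (rule someI)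
    have "dist u t * 1 \<le> dist u t * norm v"
      using v by (intro mult_left_mono) auto
    also have "\<dots> = dist (a + u *\<^sub>R v) (a + t *\<^sub>R v)"
      by (simp add: dist_norm flip: scaleR_diff_left)
    also have "\<dots> \<le> diameter (U i)"
      using t u U by (intro diameter_bounded_bound) (auto simp: T_def)
    finally show "t \<in> I i" using t by (auto simp: I_def u_def)
  qed
  then have "(\<Union>i. T i) \<subseteq> (\<Union>i. I i)"
    by (intro UN_mono) auto
  moreover have "{0..1} \<subseteq> (\<Union>i. T i)"
    unfolding T_def using subsetD[OF cover] subsetD[OF A] by blast
  ultimately have "{0..1} \<subseteq> (\<Union>i. I i)"
    by (rule order_trans[rotated])
  (* The cases s = 0 and diameter 0 are separate because diam_powr and powr treat them differently. *)
  have I_le: "emeasure lborel (I i) \<le> 2 * diam_powr s (U i)" for i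
  proof (cases "T i = {}")
    case False
    then have "U i \<noteq> {}" by (auto simp: T_def)
    have d: "0 \<le> diameter (U i)" "diameter (U i) \<le> 1"
      using U by (auto intro: diameter_ge_0)
    have "emeasure lborel (I i) = ennreal (2 * diameter (U i))"
      using False d by (simp add: I_def cball_eq_atLeastAtMost)
    also have "\<dots> = 2 * ennreal (diameter (U i))"
      using d by (simp add: ennreal_mult)
    also have "ennreal (diameter (U i)) \<le> diam_powr s (U i)"
    proof (cases "s = 0 \<or> diameter (U i) = 0")
      case False
      then have "diameter (U i) powr 1 \<le> diameter (U i) powr s"
        using d s by (intro powr_mono') auto
      then show ?thesis using False \<open>U i \<noteq> {}\<close> d by (auto simp: diam_powr_def intro!: ennreal_leI)
    qed (use d \<open>U i \<noteq> {}\<close> in \<open>auto simp: diam_powr_def\<close>)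
    finally show ?thesis by (simp add: mult_left_mono)
  qed (auto simp: I_def)
  have "1 = emeasure lborel {0..1::real}" by simp
  also have "\<dots> \<le> emeasure lborel (\<Union>i. I i)"
    by (rule emeasure_mono) (use \<open>{0..1} \<subseteq> (\<Union>i. I i)\<close> in \<open>auto simp: I_def\<close>)
  also have "\<dots> \<le> (\<Sum>i. emeasure lborel (I i))"
    by (rule emeasure_subadditive_countably) (auto simp: I_def)
  also have "\<dots> \<le> (\<Sum>i. 2 * diam_powr s (U i))"
    by (intro suminf_le I_le) auto
  also have "\<dots> = 2 * (\<Sum>i. diam_powr s (U i))"
    by (rule ennreal_suminf_cmult)
  finally have "ennreal (1/2) * 1 \<le> ennreal (1/2) * (2 * (\<Sum>i. diam_powr s (U i)))"
    by (rule mult_left_mono) simp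
  also have "\<dots> = (ennreal (1/2) * ennreal 2) * (\<Sum>i. diam_powr s (U i))"
    by (simp add: mult.assoc)
  also have "ennreal (1/2) * ennreal 2 = 1"
    by (subst ennreal_mult[symmetric]) auto
  finally show "ennreal (1/2) \<le> (\<Sum>i. diam_powr s (U i))" by simp
qed

lemma hausdorff_dim_eq_1I:
  fixes a v :: "'a::euclidean_space"
  assumes v: "1 \<le> norm v" and A: "range (\<lambda>t. a + t *\<^sub>R v) \<subseteq> A"
    and null: "\<And>s. 1 < s \<Longrightarrow> hausdorff_measure s A = 0"
  shows "hausdorff_dim A = 1"
proof (rule antisym)
  show "hausdorff_dim A \<le> 1"
  proof (rule ennreal_le_epsilon)
    fix e :: real assume "0 < e"
    then have "hausdorff_dim A \<le> ennreal (1 + e)"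
      unfolding hausdorff_dim_def by (intro INF_lower) (auto intro: null)
    then show "hausdorff_dim A \<le> 1 + ennreal e"
      using \<open>0 < e\<close> by (simp add: ennreal_plus)
  qed
  show "1 \<le> hausdorff_dim A"
    unfolding hausdorff_dim_def
  proof (rule INF_greatest, clarify)
    fix s :: real assume s: "0 \<le> s" "hausdorff_measure s A = 0"
    have "\<not> s < 1"
    proof
      assume "s < 1"
      with s v A have "ennreal (1/2) \<le> hausdorff_premeasure s 1 A"
        by (intro hausdorff_premeasure_line_ge) auto
      also have "\<dots> \<le> hausdorff_measure s A"
        unfolding hausdorff_measure_def by (rule SUP_upper) simp
      finally show False using s(2) by (simp add: ennreal_eq_0_iff)
    qed
    then show "1 \<le> ennreal s" by simp
  qed
qed

section \<open>Limsup sets of thin tubes\<close>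

text \<open>The tube of radius \<open>r\<close> about a segment of length of order \<open>n\<close> is covered by about \<open>2 * n / r\<close> balls
  of radius \<open>3 * r\<close> centred on the segment. So a tube has \<open>s\<close>-cost of order \<open>n * r powr (s - 1)\<close>, which
  is small for small \<open>r\<close> as soon as \<open>s > 1\<close>.\<close>

lemma tube_point_in_ball:
  fixes a v :: "'a::real_normed_vector"
  assumes r: "0 < r" and v: "norm v \<le> 2" and t: "\<bar>t\<bar> \<le> real n" and z: "dist z (a + t *\<^sub>R v) \<le> r"
  shows "\<exists>j < nat \<lceil>2 * n / r\<rceil> + 1. z \<in> cball (a + (j * r - n) *\<^sub>R v) (3 * r)"
proof (intro exI conjI)
  (* The centres are spaced by r in the parameter, starting at the parameter - n. *)
  define j where "j = nat \<lfloor>(t + n) / r\<rfloor>"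
  have nn: "0 \<le> (t + n) / r" using t r by auto
  have "(t + n) / r \<le> 2 * n / r" using t r by (intro divide_right_mono) auto
  then have "\<lfloor>(t + n) / r\<rfloor> \<le> \<lceil>2 * n / r\<rceil>" by linarith
  then show "j < nat \<lceil>2 * n / r\<rceil> + 1" unfolding j_def by linarith
  have "real j \<le> (t + n) / r" "(t + n) / r < real j + 1"
    using nn by (auto simp: j_def)
  then have "\<bar>t - (j * r - n)\<bar> \<le> r"
    using r by (auto simp: field_simps abs_if)
  then have "dist (a + t *\<^sub>R v) (a + (j * r - n) *\<^sub>R v) \<le> r * 2"
    using v by (auto simp: dist_norm simp flip: scaleR_diff_left intro!: mult_mono)
  with z show "z \<in> cball (a + (j * r - n) *\<^sub>R v) (3 * r)"
    using dist_triangle[of z "a + (j * r - n) *\<^sub>R v" "a + t *\<^sub>R v"] by (simp add: dist_commute)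
qed

text \<open>How small a radius has to be in order that \<open>N\<close> tubes of that radius are cheap: the bound depends
  on the number \<open>N\<close>, so the radius has to be chosen after the tubes have been counted.\<close>

lemma powr_gauge:
  assumes "0 < e" "0 < (c::real)"
  obtains \<tau> :: "nat \<Rightarrow> real" where "\<And>N. 0 < \<tau> N" "\<And>N r. 0 < r \<Longrightarrow> r \<le> \<tau> N \<Longrightarrow> N * r powr e \<le> c"
proof (rule that[of "\<lambda>N. (c / (real N + 1)) powr (1 / e)"])
  fix N :: nat and r :: real
  assume r: "0 < r" "r \<le> (c / (real N + 1)) powr (1 / e)"
  then have "r powr e \<le> ((c / (real N + 1)) powr (1 / e)) powr e"
    using assms by (intro powr_mono2) auto
  also have "\<dots> = c / (real N + 1)" using assms by (simp add: powr_powr)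
  finally have "N * r powr e \<le> N * (c / (real N + 1))" by (intro mult_left_mono) auto
  also have "\<dots> \<le> c" using assms by (simp add: field_simps)
  finally show "N * r powr e \<le> c" .
qed (use assms in auto)

text \<open>The radius of the tubes is written \<open>q n / 6\<close>, so that the covering balls have diameter \<open>q n\<close>. The
  exponent \<open>1 / (real n + 1)\<close> in the hypothesis on \<open>q\<close> tends to \<open>0\<close>; it is eventually smaller than \<open>s - 1\<close>,
  which makes one choice of tubes good for every \<open>s > 1\<close>.\<close>

lemma hausdorff_measure_tubes_eq_0:
  fixes A :: "'a::euclidean_space set" and Q :: "nat \<Rightarrow> ('a \<times> 'a) set" and q :: "nat \<Rightarrow> real"
  assumes s: "1 < s"
    and Q: "\<And>n. finite (Q n)" "\<And>n a v. (a, v) \<in> Q n \<Longrightarrow> norm v \<le> 2"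
    and q: "\<And>n. 0 < q n" "\<And>n. q n \<le> 1 / (real n + 1)"
    and sum: "\<And>n. card (Q n) * q n powr (1 / (real n + 1)) \<le> (1/2) ^ n / (12 * (real n + 1))"
    and A: "\<And>z. z \<in> A \<Longrightarrow> \<exists>\<^sub>F n in sequentially.
              \<exists>(a, v)\<in>Q n. \<exists>t. \<bar>t\<bar> \<le> real n \<and> dist z (a + t *\<^sub>R v) \<le> q n / 6"
  shows "hausdorff_measure s A = 0"
proof -
  define M where "M n = nat \<lceil>2 * n / (q n / 6)\<rceil> + 1" for n
  define I where "I n = Q n \<times> {..<M n}" for n
  have "\<forall>n. \<exists>f. bij_betw f {0..<card (I n)} (I n)"
    using Q(1) by (intro allI ex_bij_betw_nat_finite) (auto simp: I_def)
  then obtain f where f: "\<And>n. bij_betw (f n) {0..<card (I n)} (I n)" by metis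
  define B :: "nat \<Rightarrow> ('a \<times> 'a) \<times> nat \<Rightarrow> 'a set"
    where "B n = (\<lambda>((a, v), j). cball (a + (real j * (q n / 6) - n) *\<^sub>R v) (3 * (q n / 6)))" for n
  define C where "C n i = (if i < card (I n) then B n (f n i) else {})" for n i
  have B: "diameter (B n p) = q n" "bounded (B n p)" for n p
    using q(1)[of n] by (auto simp: B_def split: prod.split)
  have q1: "q n \<le> 1" for n
    using q(2)[of n] by (rule order_trans) simp
  show ?thesis
  proof (rule hausdorff_measure_limsup_eq_0[where C = C and K = "\<lambda>n. card (I n)" and d = q])
    show "bounded (C n i)" "diameter (C n i) \<le> q n" for n i
      using B[of n] q(1)[of n] by (auto simp: C_def)
    have lim: "(\<lambda>n. 1 / (real n + 1)) \<longlonglongrightarrow> 0"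
      using LIMSEQ_inverse_real_of_nat by (simp add: inverse_eq_divide add.commute)
    from lim show "q \<longlonglongrightarrow> 0"
      by (rule tendsto_sandwich[OF _ _ tendsto_const, rotated 2]) (use q in \<open>auto simp: less_imp_le\<close>)
    have "\<forall>\<^sub>F n in sequentially. 1 / (real n + 1) < s - 1"
      using lim s by (intro order_tendstoD) auto
    then show "\<forall>\<^sub>F n in sequentially. (\<Sum>i<card (I n). diameter (C n i) powr s) \<le> (1/2) ^ n"
    proof eventually_elim
      case (elim n)
      define r where "r = q n / 6"
      have r: "0 < r" "r \<le> 1" using q(1)[of n] q1[of n] by (auto simp: r_def)
      have "0 \<le> 2 * n / r" using r by simp
      then have "real (M n) \<le> 2 * n / r + 2" unfolding M_def r_def by linarith
      also have "\<dots> \<le> 2 * n / r + 2 / r" using r by (simp add: field_simps)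
      also have "\<dots> = 12 * (real n + 1) / q n" using r by (simp add: r_def field_simps)
      finally have M: "real (M n) \<le> 12 * (real n + 1) / q n" .
      have "q n powr s \<le> q n powr (1 + 1 / (real n + 1))"
        using q(1)[of n] q1[of n] elim by (intro powr_mono') auto
      also have "\<dots> = q n * q n powr (1 / (real n + 1))"
        using q(1)[of n] by (simp add: powr_add)
      finally have qs: "q n powr s \<le> q n * q n powr (1 / (real n + 1))" .
      have "(\<Sum>i<card (I n). diameter (C n i) powr s) = card (Q n) * (M n * q n powr s)"
        by (simp add: C_def B I_def card_cartesian_product)
      also have "\<dots> \<le> card (Q n) * (12 * (real n + 1) / q n * (q n * q n powr (1 / (real n + 1))))"
        using M qs q(1)[of n] by (intro mult_left_mono mult_mono) auto
      also have "\<dots> = 12 * (real n + 1) * (card (Q n) * q n powr (1 / (real n + 1)))"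
        using q(1)[of n] by simp
      also have "\<dots> \<le> 12 * (real n + 1) * ((1/2) ^ n / (12 * (real n + 1)))"
        using sum by (intro mult_left_mono) auto
      also have "\<dots> = (1/2) ^ n" by simp
      finally show ?case .
    qed
    show "\<exists>\<^sub>F n in sequentially. \<exists>i. z \<in> C n i" if "z \<in> A" for z
      using A[OF that]
    proof (rule frequently_elim1)
      fix n assume "\<exists>(a, v)\<in>Q n. \<exists>t. \<bar>t\<bar> \<le> real n \<and> dist z (a + t *\<^sub>R v) \<le> q n / 6"
      then obtain a v t where *: "(a, v) \<in> Q n" "\<bar>t\<bar> \<le> real n" "dist z (a + t *\<^sub>R v) \<le> q n / 6" by auto
      obtain j where j: "j < M n" "z \<in> B n ((a, v), j)"
        using tube_point_in_ball[OF _ Q(2)[OF *(1)] *(2,3)] q(1)[of n] by (auto simp: M_def B_def)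
      then have "((a, v), j) \<in> I n" using * by (auto simp: I_def)
      then obtain i where "i < card (I n)" "f n i = ((a, v), j)"
        using f[of n] by (auto simp: bij_betw_def) (metis atLeastLessThan_iff imageE)
      with j(2) have "z \<in> C n i" by (simp add: C_def)
      then show "\<exists>i. z \<in> C n i" ..
    qed
  qed (use s in \<open>auto simp: C_def\<close>)
qed

section \<open>Monotone functions splitting the interval at every scale\<close>

text \<open>Functions on \<open>{0..1}\<close> are represented by their constant extensions to the real line, that is by the
  functions invariant under composition with this retraction onto \<open>{0..1}\<close>. They then belong to a
  Banach space of bounded continuous functions.\<close>

definition unit_clip :: "real \<Rightarrow> real" where
  "unit_clip x = max 0 (min 1 x)"

lemma unit_clip_simps [simp]:
  "0 \<le> unit_clip x" "unit_clip x \<le> 1" "unit_clip (unit_clip x) = unit_clip x"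
  by (auto simp: unit_clip_def)

lemma unit_clip_id [simp]: "0 \<le> x \<Longrightarrow> x \<le> 1 \<Longrightarrow> unit_clip x = x"
  by (auto simp: unit_clip_def)

lemma unit_clip_ge1: "1 \<le> x \<Longrightarrow> unit_clip x = 1"
  and unit_clip_le0: "x \<le> 0 \<Longrightarrow> unit_clip x = 0"
  by (auto simp: unit_clip_def)

lemma mono_unit_clip: "mono unit_clip"
  by (auto simp: unit_clip_def mono_def)

lemma unit_clip_nonexpansive: "\<bar>unit_clip x - unit_clip y\<bar> \<le> \<bar>x - y\<bar>"
  unfolding unit_clip_def by (smt (verit) max_def min_def)

lemma continuous_on_unit_clip [continuous_intros]:
  "continuous_on A f \<Longrightarrow> continuous_on A (\<lambda>x. unit_clip (f x))"
  unfolding unit_clip_def by (intro continuous_intros)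

text \<open>A continuous staircase close to the identity of \<open>{0..1}\<close>: it climbs from \<open>i / k\<close> to \<open>(i + 1) / k\<close> on
  the short interval from \<open>i / k\<close> to \<open>i / k + \<eta>\<close> and is then constant up to \<open>(i + 1) / k\<close>.\<close>

definition staircase :: "nat \<Rightarrow> real \<Rightarrow> real \<Rightarrow> real" where
  "staircase k \<eta> x = (\<Sum>i<k. unit_clip ((unit_clip x - real i / k) / \<eta>)) / k"

lemma staircase_value:
  assumes k: "0 < k" and \<eta>: "0 < \<eta>" "\<eta> \<le> 1 / k"
  obtains j where "j < k" "real j / k \<le> unit_clip x" "unit_clip x \<le> real (Suc j) / k"
    "staircase k \<eta> x = (j + unit_clip ((unit_clip x - real j / k) / \<eta>)) / k"
proof -
  define y where "y = unit_clip x"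
  have y: "0 \<le> y" "y \<le> 1" by (auto simp: y_def)
  obtain j where j: "j < k" "real j / k \<le> y" "y \<le> real (Suc j) / k"
  proof (cases "y = 1")
    case True
    show ?thesis by (rule that[of "k - 1"]) (use k True in \<open>auto simp: field_simps of_nat_diff\<close>)
  next
    case False
    define j where "j = nat \<lfloor>k * y\<rfloor>"
    have "k * y < k" using False y k by simp
    then have 1: "real j \<le> k * y" "k * y < real j + 1"
      using y k by (auto simp: j_def)
    show ?thesis
    proof (rule that[of j])
      show "j < k" using 1 \<open>k * y < k\<close> by linarith
    qed (use 1 k in \<open>auto simp: field_simps\<close>)
  qed
  let ?t = "\<lambda>i. unit_clip ((y - real i / k) / \<eta>)"
  have "(\<Sum>i<k. ?t i) = (\<Sum>i<j. ?t i) + (\<Sum>i=j..<k. ?t i)"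
    using j(1) by (simp add: lessThan_atLeast0 sum.atLeastLessThan_concat)
  also have "(\<Sum>i<j. ?t i) = (\<Sum>i<j. 1)"
  proof (rule sum.cong)
    fix i assume "i \<in> {..<j}"
    then have "real (Suc i) / k \<le> real j / k" using k by (intro divide_right_mono) auto
    with j \<eta> have "\<eta> \<le> y - real i / k" by (simp add: add_divide_distrib)
    then show "?t i = 1" using \<eta> by (intro unit_clip_ge1) simp
  qed simp
  also have "(\<Sum>i=j..<k. ?t i) = ?t j + (\<Sum>i=Suc j..<k. ?t i)"
    using j(1) by (simp add: sum.atLeast_Suc_lessThan)
  also have "(\<Sum>i=Suc j..<k. ?t i) = 0"
  proof (rule sum.neutral, rule ballI)
    fix i assume "i \<in> {Suc j..<k}"
    then have "real (Suc j) / k \<le> real i / k" using k by (intro divide_right_mono) auto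
    with j have "y - real i / k \<le> 0" by simp
    then show "?t i = 0" using \<eta> by (intro unit_clip_le0) (simp add: divide_nonpos_pos)
  qed
  finally have "staircase k \<eta> x = (j + ?t j) / k"
    by (simp add: staircase_def y_def)
  with j show ?thesis by (intro that[of j]) (auto simp: y_def)
qed

lemma staircase_near_unit_clip:
  assumes "0 < k" "0 < \<eta>" "\<eta> \<le> 1 / k"
  shows "\<bar>staircase k \<eta> x - unit_clip x\<bar> \<le> 1 / k"
proof -
  obtain j where j: "real j / k \<le> unit_clip x" "unit_clip x \<le> real (Suc j) / k"
    "staircase k \<eta> x = (j + unit_clip ((unit_clip x - real j / k) / \<eta>)) / k" (is "_ = (_ + ?c) / _")
    using staircase_value[OF assms] by metis
  have "0 \<le> ?c / k" "?c / k \<le> 1 / k" by (auto intro: divide_right_mono)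
  with j show ?thesis
    unfolding add_divide_distrib of_nat_Suc abs_le_iff by linarith
qed

lemma staircase_flat:
  assumes "0 < k" "0 < \<eta>" "\<eta> \<le> 1 / k" "x \<in> {0..1}"
  shows "\<exists>i\<le>k. \<bar>x - real i / k\<bar> < \<eta> \<or> staircase k \<eta> x = real i / k"
proof -
  obtain j where j: "j < k" "real j / k \<le> unit_clip x"
    "staircase k \<eta> x = (j + unit_clip ((unit_clip x - real j / k) / \<eta>)) / k"
    using staircase_value[OF assms(1-3)] by metis
  have x: "unit_clip x = x" using assms by simp
  show ?thesis
  proof (cases "x - real j / k < \<eta>")
    case True
    then show ?thesis using j x by (intro exI[of _ j]) auto
  next
    case False
    then have "unit_clip ((x - real j / k) / \<eta>) = 1"
      using assms by (intro unit_clip_ge1) simp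
    then show ?thesis using j x by (intro exI[of _ "Suc j"]) auto
  qed
qed

lemma mono_staircase: "0 < \<eta> \<Longrightarrow> mono (staircase k \<eta>)"
  unfolding staircase_def mono_def
  by (auto intro!: divide_right_mono sum_mono monoD[OF mono_unit_clip] diff_right_mono)

lemma continuous_on_staircase: "0 < k \<Longrightarrow> 0 < \<eta> \<Longrightarrow> continuous_on A (staircase k \<eta>)"
  unfolding staircase_def
  by (intro continuous_intros) auto

lemma staircase_unit_clip [simp]: "staircase k \<eta> (unit_clip x) = staircase k \<eta> x"
  by (simp add: staircase_def)

definition slope_functions :: "(real \<Rightarrow>\<^sub>C real) set" where
  "slope_functions = {\<phi>. mono (apply_bcontfun \<phi>) \<and> (\<forall>x. 0 \<le> \<phi> x \<and> \<phi> x \<le> 1 \<and> \<phi> (unit_clip x) = \<phi> x)}"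

text \<open>The condition at one scale. The tolerance \<open>\<rho>\<close> is bounded by a gauge \<open>\<tau>\<close> of the number of points,
  because the neighbourhoods of \<open>P\<close> and \<open>S\<close> have to be cheap in total, however many points are used.
  The smaller tolerance \<open>e\<close> for the values makes the condition open in \<open>\<phi>\<close>.\<close>

definition finely_split :: "(nat \<Rightarrow> real) \<Rightarrow> (real \<Rightarrow>\<^sub>C real) set" where
  "finely_split \<tau> = {\<phi> :: real \<Rightarrow>\<^sub>C real. \<exists>P S \<rho> e. finite P \<and> finite S \<and> e < \<rho> \<and> 0 < \<rho> \<and> \<rho> \<le> \<tau> (card P + card S) \<and>
     (\<forall>x\<in>{0..1}. (\<exists>p\<in>P. \<bar>x - p\<bar> < \<rho>) \<or> (\<exists>s\<in>S. \<bar>\<phi> x - s\<bar> < e))}"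

lemma bcontfun_tendsto_apply:
  fixes f :: "nat \<Rightarrow> 'a::topological_space \<Rightarrow>\<^sub>C 'b::metric_space"
  assumes "f \<longlonglongrightarrow> l"
  shows "(\<lambda>n. f n x) \<longlonglongrightarrow> l x"
  using tendsto_uniform_limitI[OF tendsto_bcontfun_uniform_limit[OF assms]] by auto

lemma closed_slope_functions: "closed slope_functions"
  unfolding closed_sequential_limits
proof (intro allI impI, elim conjE)
  fix f :: "nat \<Rightarrow> real \<Rightarrow>\<^sub>C real" and l
  assume f: "\<forall>n. f n \<in> slope_functions" and "f \<longlonglongrightarrow> l"
  then have l: "(\<lambda>n. f n x) \<longlonglongrightarrow> l x" for x
    by (intro bcontfun_tendsto_apply)
  have "l x \<le> l y" if "x \<le> y" for x y
    using f that by (intro LIMSEQ_le[OF l l]) (auto simp: slope_functions_def mono_def)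
  moreover have "0 \<le> l x" "l x \<le> 1" for x
    using f by (auto intro!: LIMSEQ_le_const[OF l] LIMSEQ_le_const2[OF l] simp: slope_functions_def)
  moreover have "l (unit_clip x) = l x" for x
    using l[of x] l[of "unit_clip x"] f by (auto simp: slope_functions_def intro: LIMSEQ_unique)
  ultimately show "l \<in> slope_functions"
    by (auto simp: slope_functions_def mono_def)
qed

lemma bcontfun_of_unit_valued:
  fixes f :: "real \<Rightarrow> real"
  assumes "continuous_on UNIV f" "\<And>x. 0 \<le> f x" "\<And>x. f x \<le> 1"
  obtains \<psi> where "apply_bcontfun \<psi> = f"
proof -
  have "f \<in> bcontfun" using assms by (intro bcontfun_normI[of _ 1]) auto
  then show ?thesis using that by (elim bcontfunE) auto
qed

lemma open_finely_split: "open (finely_split \<tau>)"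
  unfolding open_dist
proof
  fix \<phi> assume "\<phi> \<in> finely_split \<tau>"
  then obtain P S \<rho> e where *: "finite P" "finite S" "e < \<rho>" "0 < \<rho>" "\<rho> \<le> \<tau> (card P + card S)"
    "\<And>x. x \<in> {0..1} \<Longrightarrow> (\<exists>p\<in>P. \<bar>x - p\<bar> < \<rho>) \<or> (\<exists>s\<in>S. \<bar>\<phi> x - s\<bar> < e)"
    unfolding finely_split_def by blast
  show "\<exists>d>0. \<forall>\<psi>. dist \<psi> \<phi> < d \<longrightarrow> \<psi> \<in> finely_split \<tau>"
  proof (intro exI[of _ "(\<rho> - e) / 2"] conjI allI impI)
    fix \<psi> :: "real \<Rightarrow>\<^sub>C real" assume d: "dist \<psi> \<phi> < (\<rho> - e) / 2"
    have "\<bar>\<psi> x - s\<bar> < e + (\<rho> - e) / 2" if "\<bar>\<phi> x - s\<bar> < e" for x s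
      using dist_fun_lt_imp_dist_val_lt[OF d, of x] that unfolding dist_real_def by linarith
    then have "\<forall>x\<in>{0..1}. (\<exists>p\<in>P. \<bar>x - p\<bar> < \<rho>) \<or> (\<exists>s\<in>S. \<bar>\<psi> x - s\<bar> < e + (\<rho> - e) / 2)"
      using *(6) by blast
    moreover have "e + (\<rho> - e) / 2 < \<rho>" using \<open>e < \<rho>\<close> by (simp add: field_simps)
    ultimately show "\<psi> \<in> finely_split \<tau>"
      unfolding finely_split_def using * by blast
  qed (use \<open>e < \<rho>\<close> in auto)
qed

text \<open>Composing \<open>\<phi>\<close> with a fine staircase \<open>r\<close> moves it little, by uniform continuity. Off the
  intervals where \<open>r\<close> climbs, \<open>\<phi> \<circ> r\<close> takes only the values of \<open>\<phi>\<close> at the points \<open>i / k\<close>. The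
  sets \<open>P\<close> and \<open>S\<close>, hence also the tolerance demanded by \<open>\<tau>\<close>, do not depend on the length of the
  climbing intervals, which can therefore be chosen below that tolerance.\<close>

lemma finely_split_dense:
  assumes \<phi>: "\<phi> \<in> slope_functions" and \<epsilon>: "0 < \<epsilon>" and \<tau>: "\<And>N. 0 < \<tau> N"
  obtains \<psi> where "\<psi> \<in> slope_functions" "\<psi> \<in> finely_split \<tau>" "dist \<psi> \<phi> \<le> \<epsilon>"
proof -
  have "uniformly_continuous_on {0..1} \<phi>"
    by (intro compact_uniformly_continuous) auto
  then obtain d where d: "0 < d" "\<And>x y. x \<in> {0..1} \<Longrightarrow> y \<in> {0..1} \<Longrightarrow> dist y x < d \<Longrightarrow> dist (\<phi> y) (\<phi> x) < \<epsilon>"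
    using \<epsilon> unfolding uniformly_continuous_on_def by metis
  obtain k where k: "0 < k" "1 / real k < d"
    using reals_Archimedean[OF d(1)] by (auto simp: inverse_eq_divide) (metis of_nat_Suc zero_less_Suc)
  define P where "P = (\<lambda>i. real i / k) ` {..k}"
  define S where "S = \<phi> ` P"
  define \<rho> where "\<rho> = \<tau> (card P + card S)"
  have \<rho>: "0 < \<rho>" by (simp add: \<rho>_def \<tau>)
  define \<eta> where "\<eta> = min \<rho> (1 / k)"
  have \<eta>: "0 < \<eta>" "\<eta> \<le> 1 / k" "\<eta> \<le> \<rho>" using \<rho> k by (auto simp: \<eta>_def)
  let ?r = "staircase k \<eta>"
  have \<phi>': "mono \<phi>" "0 \<le> \<phi> x" "\<phi> x \<le> 1" "\<phi> (unit_clip x) = \<phi> x" for x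
    using \<phi> by (auto simp: slope_functions_def)
  obtain \<psi> where \<psi>: "apply_bcontfun \<psi> = (\<lambda>x. \<phi> (?r x))"
  proof (rule bcontfun_of_unit_valued)
    show "continuous_on UNIV (\<lambda>x. \<phi> (?r x))"
      by (rule continuous_on_compose2[OF _ continuous_on_staircase[OF k(1) \<eta>(1)], of UNIV]) auto
  qed (use \<phi>' in auto)
  have "\<psi> \<in> slope_functions"
    using \<phi>' monoD[OF mono_staircase[OF \<eta>(1)]] by (auto simp: slope_functions_def \<psi> mono_def)
  moreover have "\<psi> \<in> finely_split \<tau>"
  proof -
    have "(\<exists>p\<in>P. \<bar>x - p\<bar> < \<rho>) \<or> (\<exists>s\<in>S. \<bar>\<psi> x - s\<bar> < \<rho> / 2)" if x: "x \<in> {0..1}" for x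
    proof -
      obtain i where i: "i \<le> k" "\<bar>x - real i / k\<bar> < \<eta> \<or> ?r x = real i / k"
        using staircase_flat[OF k(1) \<eta>(1,2) x] by blast
      have "real i / k \<in> P" using i(1) by (auto simp: P_def)
      then have "\<phi> (real i / k) \<in> S" by (auto simp: S_def)
      from i(2) show ?thesis
      proof
        assume "\<bar>x - real i / k\<bar> < \<eta>"
        with \<eta>(3) \<open>real i / k \<in> P\<close> show ?thesis by fastforce
      next
        assume "?r x = real i / k"
        with \<open>\<phi> (real i / k) \<in> S\<close> \<rho> show ?thesis by (auto simp: \<psi> intro!: bexI[of _ "\<phi> (real i / k)"])
      qed
    qed
    moreover have "finite P" "finite S" by (auto simp: P_def S_def)
    ultimately show ?thesis
      using \<rho> unfolding finely_split_def
      by (intro CollectI exI[of _ P] exI[of _ S] exI[of _ \<rho>] exI[of _ "\<rho>/2"]) (auto simp: \<rho>_def)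
  qed
  moreover have "dist \<psi> \<phi> \<le> \<epsilon>"
  proof (rule dist_bound)
    fix x
    define c where "c = unit_clip (?r x)"
    have "\<bar>c - unit_clip x\<bar> \<le> \<bar>?r x - unit_clip x\<bar>"
      using unit_clip_nonexpansive[of "?r x" "unit_clip x"] by (simp add: c_def)
    also have "\<dots> \<le> 1 / k"
      by (rule staircase_near_unit_clip[OF k(1) \<eta>(1,2)])
    finally have "dist c (unit_clip x) < d"
      using k by (simp add: dist_real_def)
    then have "dist (\<phi> c) (\<phi> (unit_clip x)) < \<epsilon>"
      by (intro d(2)) (auto simp: c_def)
    then show "dist (\<psi> x) (\<phi> x) \<le> \<epsilon>"
      by (simp add: \<psi> c_def \<phi>')
  qed
  ultimately show ?thesis by (rule that)
qed

lemma open_increase: "open {\<phi> :: real \<Rightarrow>\<^sub>C real. \<phi> p < \<phi> q}"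
  unfolding open_dist
proof clarify
  fix \<phi> :: "real \<Rightarrow>\<^sub>C real" assume *: "\<phi> p < \<phi> q"
  show "\<exists>e>0. \<forall>\<psi>. dist \<psi> \<phi> < e \<longrightarrow> \<psi> \<in> {\<phi> :: real \<Rightarrow>\<^sub>C real. \<phi> p < \<phi> q}"
  proof (intro exI[of _ "(\<phi> q - \<phi> p) / 2"] conjI allI impI)
    fix \<psi> :: "real \<Rightarrow>\<^sub>C real" assume d: "dist \<psi> \<phi> < (\<phi> q - \<phi> p) / 2"
    show "\<psi> \<in> {\<phi> :: real \<Rightarrow>\<^sub>C real. \<phi> p < \<phi> q}"
      using dist_fun_lt_imp_dist_val_lt[OF d, of p] dist_fun_lt_imp_dist_val_lt[OF d, of q]
      by (simp add: dist_real_def abs_if field_simps split: if_splits)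
  qed (use * in auto)
qed

text \<open>Mixing in a small multiple of \<open>unit_clip\<close>, the identity on \<open>{0..1}\<close>, makes a nondecreasing function
  strictly increasing there and keeps its values in \<open>{0..1}\<close>.\<close>

lemma increase_dense:
  assumes \<phi>: "\<phi> \<in> slope_functions" and \<epsilon>: "0 < \<epsilon>" and pq: "0 \<le> p" "p < q" "q \<le> 1"
  obtains \<psi> where "\<psi> \<in> slope_functions" "\<psi> p < \<psi> q" "dist \<psi> \<phi> \<le> \<epsilon>"
proof -
  define t where "t = min \<epsilon> 1"
  have t: "0 < t" "t \<le> 1" "t \<le> \<epsilon>" using \<epsilon> by (auto simp: t_def)
  have \<phi>': "mono \<phi>" "0 \<le> \<phi> x" "\<phi> x \<le> 1" "\<phi> (unit_clip x) = \<phi> x" for x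
    using \<phi> by (auto simp: slope_functions_def)
  define f where "f x = (1 - t) * \<phi> x + t * unit_clip x" for x
  have f: "0 \<le> f x" "f x \<le> 1" for x
    using \<phi>' t convex_bound_le[of "\<phi> x" 1 "unit_clip x" "1 - t" t] by (auto simp: f_def)
  obtain \<psi> where \<psi>: "apply_bcontfun \<psi> = f"
    by (rule bcontfun_of_unit_valued[of f]) (use f in \<open>auto simp: f_def[abs_def] intro!: continuous_intros\<close>)
  have fm: "mono f"
    unfolding f_def mono_def using t monoD[OF \<phi>'(1)] monoD[OF mono_unit_clip]
    by (auto intro!: add_mono mult_left_mono)
  have "\<psi> \<in> slope_functions"
    using fm f by (auto simp: slope_functions_def \<psi> f_def \<phi>')
  moreover have "\<psi> p < \<psi> q"
    using t pq monoD[OF \<phi>'(1), of p q] by (auto simp: \<psi> f_def intro!: add_le_less_mono mult_left_mono)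
  moreover have "dist \<psi> \<phi> \<le> \<epsilon>"
  proof (rule dist_bound)
    fix x
    have "\<psi> x - \<phi> x = t * (unit_clip x - \<phi> x)" by (simp add: \<psi> f_def algebra_simps)
    moreover have "\<bar>unit_clip x - \<phi> x\<bar> \<le> 1"
      using \<phi>'(2,3)[of x] unit_clip_simps(1,2)[of x] unfolding abs_le_iff by linarith
    ultimately have "\<bar>\<psi> x - \<phi> x\<bar> \<le> t"
      using t by (simp add: abs_mult mult_left_le)
    then show "dist (\<psi> x) (\<phi> x) \<le> \<epsilon>" using t by (simp add: dist_real_def)
  qed
  ultimately show ?thesis by (rule that)
qed

text \<open>By Baire's theorem, a generic nondecreasing \<open>g\<close> is finely split at every scale \<open>n\<close> simultaneously and
  strictly increasing. The latter is a countable intersection of open dense conditions because it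
  suffices to compare rational points.\<close>

theorem exists_finely_split_slope:
  fixes \<tau> :: "nat \<Rightarrow> nat \<Rightarrow> real"
  assumes \<tau>: "\<And>n N. 0 < \<tau> n N"
  obtains g :: "real \<Rightarrow> real" and P S :: "nat \<Rightarrow> real set" and \<rho> :: "nat \<Rightarrow> real"
  where "continuous_on {0..1} g" "strict_mono_on {0..1} g" "\<And>x. 0 \<le> g x" "\<And>x. g x \<le> 1"
    "\<And>n. finite (P n)" "\<And>n. finite (S n)" "\<And>n. 0 < \<rho> n" "\<And>n. \<rho> n \<le> \<tau> n (card (P n) + card (S n))"
    "\<And>n x. x \<in> {0..1} \<Longrightarrow> (\<exists>p\<in>P n. \<bar>x - p\<bar> < \<rho> n) \<or> (\<exists>s\<in>S n. \<bar>g x - s\<bar> < \<rho> n)"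
proof -
  define X where "X = slope_functions"
  define Q where "Q = {(p, q). p \<in> \<rat> \<and> q \<in> \<rat> \<and> 0 \<le> p \<and> p < q \<and> q \<le> (1::real)}"
  define \<O> where "\<O> = range (\<lambda>n. finely_split (\<tau> n)) \<union> (\<lambda>(p, q). {\<phi> :: real \<Rightarrow>\<^sub>C real. \<phi> p < \<phi> q}) ` Q"
  have "countable Q"
    by (rule countable_subset[OF _ countable_SIGMA[OF countable_rat, of "\<lambda>_. \<rat>"]])
       (auto simp: Q_def countable_rat)
  then have "countable ((\<inter>) X ` \<O>)"
    by (auto simp: \<O>_def)
  have dense: "top_of_set X closure_of (X \<inter> T) = X" if "\<And>\<phi> \<epsilon>. \<phi> \<in> X \<Longrightarrow> 0 < \<epsilon> \<Longrightarrow> \<exists>\<psi>\<in>X \<inter> T. dist \<psi> \<phi> \<le> \<epsilon>" for T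
  proof -
    have "X \<subseteq> closure (X \<inter> T)"
      using that by (meson closure_approachable_le subsetI)
    then show ?thesis
      by (auto simp: closure_of_subtopology)
  qed
  have *: "openin (top_of_set X) T \<and> top_of_set X closure_of T = topspace (top_of_set X)"
    if "T \<in> (\<inter>) X ` \<O>" for T
  proof -
    obtain T' where T': "T = X \<inter> T'" "T' \<in> \<O>" using \<open>T \<in> _\<close> by auto
    have "open T' \<and> (\<forall>\<phi>\<in>X. \<forall>\<epsilon>>0. \<exists>\<psi>\<in>X \<inter> T'. dist \<psi> \<phi> \<le> \<epsilon>)"
      using T'(2) unfolding \<O>_def
    proof
      assume "T' \<in> range (\<lambda>n. finely_split (\<tau> n))"
      then obtain n where n: "T' = finely_split (\<tau> n)" by auto
      show ?thesis
        unfolding n X_def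
      proof (intro conjI ballI allI impI)
        fix \<phi> :: "real \<Rightarrow>\<^sub>C real" and \<epsilon> :: real assume "\<phi> \<in> slope_functions" "0 < \<epsilon>"
        then obtain \<psi> where "\<psi> \<in> slope_functions" "\<psi> \<in> finely_split (\<tau> n)" "dist \<psi> \<phi> \<le> \<epsilon>"
          by (rule finely_split_dense[OF _ _ \<tau>])
        then show "\<exists>\<psi>\<in>slope_functions \<inter> finely_split (\<tau> n). dist \<psi> \<phi> \<le> \<epsilon>" by auto
      qed (rule open_finely_split)
    next
      assume "T' \<in> (\<lambda>(p, q). {\<phi> :: real \<Rightarrow>\<^sub>C real. \<phi> p < \<phi> q}) ` Q"
      then obtain p q where pq: "T' = {\<phi> :: real \<Rightarrow>\<^sub>C real. \<phi> p < \<phi> q}" "0 \<le> p" "p < q" "q \<le> 1"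
        by (auto simp: Q_def)
      show ?thesis
        unfolding pq(1) X_def
      proof (intro conjI ballI allI impI)
        fix \<phi> :: "real \<Rightarrow>\<^sub>C real" and \<epsilon> :: real assume "\<phi> \<in> slope_functions" "0 < \<epsilon>"
        then obtain \<psi> where "\<psi> \<in> slope_functions" "\<psi> p < \<psi> q" "dist \<psi> \<phi> \<le> \<epsilon>"
          by (rule increase_dense[OF _ _ pq(2-4)])
        then show "\<exists>\<psi>\<in>slope_functions \<inter> {\<phi> :: real \<Rightarrow>\<^sub>C real. \<phi> p < \<phi> q}. dist \<psi> \<phi> \<le> \<epsilon>" by auto
      qed (rule open_increase)
    qed
    then show ?thesis
      using dense[of T'] unfolding T'(1) by (auto intro: openin_open_Int)
  qed
  have "completely_metrizable_space (top_of_set X)"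
    using closed_slope_functions unfolding X_def
    by (intro completely_metrizable_space_closedin completely_metrizable_space_euclidean) simp
  then have "top_of_set X closure_of \<Inter>((\<inter>) X ` \<O>) = topspace (top_of_set X)"
    by (intro Baire_category \<open>countable ((\<inter>) X ` \<O>)\<close> *) auto
  moreover have "0 \<in> X" by (auto simp: X_def slope_functions_def mono_def)
  ultimately have "\<Inter>((\<inter>) X ` \<O>) \<noteq> {}" by (metis closure_of_empty empty_iff topspace_euclidean_subtopology)
  then obtain \<phi> where "\<phi> \<in> \<Inter>((\<inter>) X ` \<O>)" by blast
  then have \<phi>: "\<phi> \<in> X \<inter> T" if "T \<in> \<O>" for T
    using that by blast
  have "\<phi> \<in> X" using \<phi>[of "finely_split (\<tau> 0)"] by (auto simp: \<O>_def)
  have "\<phi> \<in> finely_split (\<tau> n)" for n using \<phi>[of "finely_split (\<tau> n)"] by (auto simp: \<O>_def)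
  then have "\<forall>n. \<exists>P S \<rho>. finite P \<and> finite S \<and> 0 < \<rho> \<and> \<rho> \<le> \<tau> n (card P + card S) \<and>
      (\<forall>x\<in>{0..1}. (\<exists>p\<in>P. \<bar>x - p\<bar> < \<rho>) \<or> (\<exists>s\<in>S. \<bar>\<phi> x - s\<bar> < \<rho>))"
    unfolding finely_split_def by (simp, meson less_trans)
  then obtain P S \<rho> where PS: "\<And>n. finite (P n) \<and> finite (S n) \<and> 0 < \<rho> n \<and> \<rho> n \<le> \<tau> n (card (P n) + card (S n)) \<and>
      (\<forall>x\<in>{0..1}. (\<exists>p\<in>P n. \<bar>x - p\<bar> < \<rho> n) \<or> (\<exists>s\<in>S n. \<bar>\<phi> x - s\<bar> < \<rho> n))"
    by metis
  have rat: "\<phi> p < \<phi> q" if "(p, q) \<in> Q" for p q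
    using \<phi>[of "{\<phi> :: real \<Rightarrow>\<^sub>C real. \<phi> p < \<phi> q}"] that by (auto simp: \<O>_def)
  have "strict_mono_on {0..1} \<phi>"
  proof (rule strict_mono_onI)
    fix x y :: real assume xy: "x \<in> {0..1}" "y \<in> {0..1}" "x < y"
    obtain p where p: "p \<in> \<rat>" "x < p" "p < y" using Rats_dense_in_real[OF \<open>x < y\<close>] by auto
    obtain q where q: "q \<in> \<rat>" "p < q" "q < y" using Rats_dense_in_real[OF p(3)] by auto
    have "mono \<phi>" using \<open>\<phi> \<in> X\<close> by (auto simp: X_def slope_functions_def)
    then have "\<phi> x \<le> \<phi> p" "\<phi> q \<le> \<phi> y" using p q by (auto simp: mono_def)
    moreover have "\<phi> p < \<phi> q" using p q xy by (intro rat) (auto simp: Q_def)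
    ultimately show "\<phi> x < \<phi> y" by simp
  qed
  then show ?thesis
    using PS \<open>\<phi> \<in> X\<close> by (intro that[of \<phi> P S \<rho>]) (auto simp: X_def slope_functions_def)
qed

section \<open>Tangent lines of strictly convex functions\<close>

lemma strict_tangent_below:
  fixes F g :: "real \<Rightarrow> real"
  assumes F: "\<And>x. x \<in> {a..b} \<Longrightarrow> (F has_real_derivative g x) (at x within {a..b})"
    and g: "strict_mono_on {a..b} g"
    and xy: "x \<in> {a..b}" "y \<in> {a..b}" "x \<noteq> y"
  shows "F x + g x * (y - x) < F y"
proof -
  have mvt: "\<exists>z\<in>{u<..<v}. F v - F u = g z * (v - u)" if "u \<in> {a..b}" "v \<in> {a..b}" "u < v" for u v
  proof (rule mvt_simple[OF \<open>u < v\<close>])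
    fix x assume "u \<le> x" "x \<le> v"
    then show "(F has_derivative (\<lambda>h. g x * h)) (at x within {u..v})"
      using F[of x] that by (auto simp: has_field_derivative_def intro: has_derivative_subset)
  qed
  show ?thesis
  proof (cases "x < y")
    case True
    then obtain z where z: "x < z" "z < y" "F y - F x = g z * (y - x)"
      using mvt[of x y] xy by auto
    have "g x * (y - x) < g z * (y - x)"
      using z xy strict_mono_onD[OF g, of x z] by (intro mult_strict_right_mono) auto
    with z(3) show ?thesis by linarith
  next
    case False
    then obtain z where z: "y < z" "z < x" "F x - F y = g z * (x - y)"
      using mvt[of y x] xy by auto
    have "g z * (x - y) < g x * (x - y)"
      using z xy strict_mono_onD[OF g, of z x] by (intro mult_strict_right_mono) auto
    moreover have "g x * (y - x) = - (g x * (x - y))" by (simp add: algebra_simps)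
    ultimately show ?thesis using z(3) by linarith
  qed
qed

lemma strictly_convex_on_tangentsI:
  fixes F g :: "real \<Rightarrow> real"
  assumes S: "convex S"
    and tangent: "\<And>x y. x \<in> S \<Longrightarrow> y \<in> S \<Longrightarrow> x \<noteq> y \<Longrightarrow> F x + g x * (y - x) < F y"
  shows "strictly_convex_on S F"
  unfolding strictly_convex_on_def
proof (intro conjI ballI impI)
  fix x y t :: real assume *: "x \<in> S" "y \<in> S" "t \<in> {0<..<1}" "x \<noteq> y"
  define z where "z = (1 - t) *\<^sub>R x + t *\<^sub>R y"
  have "z \<in> S" unfolding z_def using * S by (intro convexD) auto
  have zx: "x - z = t * (x - y)" and zy: "y - z = (1 - t) * (y - x)"
    by (auto simp: z_def algebra_simps)
  then have "z \<noteq> x" "z \<noteq> y" using * by auto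
  have "(1 - t) * (F z + g z * (x - z)) + t * (F z + g z * (y - z)) < (1 - t) * F x + t * F y"
    using tangent[OF \<open>z \<in> S\<close> \<open>x \<in> S\<close> \<open>z \<noteq> x\<close>] tangent[OF \<open>z \<in> S\<close> \<open>y \<in> S\<close> \<open>z \<noteq> y\<close>] *
    by (intro add_strict_mono mult_strict_left_mono) auto
  also have "(1 - t) * (F z + g z * (x - z)) + t * (F z + g z * (y - z)) = F z"
    unfolding zx zy by (simp add: algebra_simps)
  finally show "F ((1 - t) *\<^sub>R x + t *\<^sub>R y) < (1 - t) * F x + t * F y"
    by (simp add: z_def)
qed (rule S)

text \<open>The tangent line depends in a Lipschitz way on its slope alone: the distance of the points of contact
  enters only through a bounded factor. This holds because convexity squeezes
  \<open>F x - F w\<close> between \<open>g w * (x - w)\<close> and \<open>g x * (x - w)\<close>.\<close>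

lemma tangent_lines_close:
  fixes F g :: "real \<Rightarrow> real"
  assumes "F x + g x * (w - x) \<le> F w" "F w + g w * (x - w) \<le> F x"
  shows "\<bar>(F x + g x * (X - x)) - (F w + g w * (X - w))\<bar> \<le> \<bar>g x - g w\<bar> * (\<bar>X - x\<bar> + \<bar>x - w\<bar>)"
proof -
  define R where "R = F x - F w - g w * (x - w)"
  have "0 \<le> R" "R \<le> (g x - g w) * (x - w)"
    using assms by (auto simp: R_def algebra_simps)
  then have "\<bar>R\<bar> \<le> \<bar>g x - g w\<bar> * \<bar>x - w\<bar>"
    by (metis abs_ge_self abs_mult abs_of_nonneg order_trans)
  moreover have "(F x + g x * (X - x)) - (F w + g w * (X - w)) = (g x - g w) * (X - x) + R"
    by (simp add: R_def algebra_simps)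
  ultimately show ?thesis
    using abs_triangle_ineq[of "(g x - g w) * (X - x)" R]
    by (simp add: abs_mult distrib_left)
qed

section \<open>The function and the lines\<close>

lemma is_line_range:
  fixes v :: "real \<times> real"
  assumes "v \<noteq> 0"
  shows "is_line (range (\<lambda>t. a + t *\<^sub>R v))"
proof -
  have "range (\<lambda>t. a + t *\<^sub>R v) = affine hull {a, a + v}"
    by (simp add: affine_hull_2_alt)
  then show ?thesis
    using assms by (simp add: is_line_def)
qed

definition vertical_line :: "real \<Rightarrow> (real \<times> real) set" where
  "vertical_line x = range (\<lambda>t. (x, 0) + t *\<^sub>R (0, 1))"

definition line_with_slope :: "real \<Rightarrow> real \<times> real \<Rightarrow> (real \<times> real) set" where
  "line_with_slope m p = range (\<lambda>t. (0, snd p - m * fst p) + t *\<^sub>R (1, m))"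

lemma mem_vertical_line: "(X, Y) \<in> vertical_line x \<longleftrightarrow> X = x"
  by (auto simp: vertical_line_def)

lemma mem_line_with_slope: "(X, Y) \<in> line_with_slope m (x, y) \<longleftrightarrow> Y = y + m * (X - x)"
  by (auto simp: line_with_slope_def algebra_simps)

theorem theorem2p5:
  shows "\<exists>(F :: real \<Rightarrow> real) (E :: (real \<times> real) set set).
           strictly_convex_on {0..1} F \<and> C1_on {0..1} F \<and>
           (\<forall>L\<in>E. is_line L) \<and>
           graph_on {0..1} F \<subseteq> \<Union>E \<and>
           (\<forall>L\<in>E. \<exists>p. L \<inter> graph_on {0..1} F = {p}) \<and>
           hausdorff_dim (\<Union>E) = 1"
proof -
  have "\<exists>\<tau>. \<forall>N. 0 < \<tau> N \<and> (\<forall>r. 0 < r \<longrightarrow> r \<le> \<tau> N \<longrightarrow>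
          real N * r powr (1 / (real n + 1)) \<le> (1/2) ^ n / (12 * (real n + 1)))" for n :: nat
    by (rule powr_gauge[of "1 / (real n + 1)" "(1/2) ^ n / (12 * (real n + 1))"]) (simp, simp, blast)
  then obtain \<tau> where \<tau>: "\<And>n N. 0 < \<tau> n N"
    "\<And>n N r. 0 < r \<Longrightarrow> r \<le> \<tau> n N \<Longrightarrow>
       real N * r powr (1 / (real n + 1)) \<le> (1/2) ^ n / (12 * (real n + 1))"
    by metis
  (* A tangent whose slope is within 2 * \<rho> n of that of a reference tangent stays, over a point X with
     abs X \<le> n, within 2 * (n + 2) * \<rho> n of it. The factor c n turns \<rho> n into six times this radius. *)
  define c where "c n = 12 * (real n + 2)" for n :: nat
  have c: "0 < c n" for n by (simp add: c_def)
  obtain g :: "real \<Rightarrow> real" and P S :: "nat \<Rightarrow> real set" and \<rho> :: "nat \<Rightarrow> real" where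
    g: "continuous_on {0..1} g" "strict_mono_on {0..1} g" "\<And>x. 0 \<le> g x" "\<And>x. g x \<le> 1"
    and PS: "\<And>n. finite (P n)" "\<And>n. finite (S n)" and \<rho>: "\<And>n. 0 < \<rho> n"
      "\<And>n. \<rho> n \<le> min (\<tau> n (card (P n) + card (S n))) (1 / (real n + 1)) / c n"
    and near: "\<And>n x. x \<in> {0..1} \<Longrightarrow> (\<exists>p\<in>P n. \<bar>x - p\<bar> < \<rho> n) \<or> (\<exists>s\<in>S n. \<bar>g x - s\<bar> < \<rho> n)"
    by (rule exists_finely_split_slope[of "\<lambda>n N. min (\<tau> n N) (1 / (real n + 1)) / c n"])
       (use \<tau>(1) c in auto)
  define F where "F x = integral {0..x} g" for x
  have F: "(F has_real_derivative g x) (at x within {0..1})" if "x \<in> {0..1}" for x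
    unfolding F_def using g(1) that by (rule integral_has_real_derivative)
  note tangent = strict_tangent_below[OF F g(2)]
  (* V is a limsup of tiny neighbourhoods of finite sets, and g maps its complement into such a limsup. *)
  define V where "V = {x \<in> {0..1}. \<exists>\<^sub>F n in sequentially. \<exists>p\<in>P n. \<bar>x - p\<bar> < \<rho> n}"
  define T where "T x = line_with_slope (g x) (x, F x)" for x
  define E where "E = vertical_line ` V \<union> T ` ({0..1} - V)"
  have mem_T: "(X, Y) \<in> T x \<longleftrightarrow> Y = F x + g x * (X - x)" for X Y x
    by (simp add: T_def mem_line_with_slope)
  have "strictly_convex_on {0..1} F"
    using tangent by (intro strictly_convex_on_tangentsI[where g = g]) auto
  moreover have "C1_on {0..1} F"
    unfolding C1_on_def using F g(1) by blast
  moreover have "\<forall>L\<in>E. is_line L"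
    by (auto simp: E_def vertical_line_def T_def line_with_slope_def zero_prod_def simp del: scaleR_Pair add_Pair
        intro!: is_line_range)
  moreover have "graph_on {0..1} F \<subseteq> \<Union>E"
  proof
    fix z assume "z \<in> graph_on {0..1} F"
    then obtain x where x: "x \<in> {0..1}" "z = (x, F x)" by (auto simp: graph_on_def)
    then have "z \<in> vertical_line x" "z \<in> T x" by (auto simp: mem_vertical_line mem_T)
    then show "z \<in> \<Union>E" using x(1) unfolding E_def by blast
  qed
  moreover have "\<forall>L\<in>E. \<exists>p. L \<inter> graph_on {0..1} F = {p}"
  proof
    fix L assume "L \<in> E"
    then obtain x where x: "x \<in> {0..1}" "L = vertical_line x \<or> L = T x"
      unfolding E_def V_def by blast
    have "(x, F x) \<in> L" using x(2) by (auto simp: mem_vertical_line mem_T)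
    have only: "X = x" if "X \<in> {0..1}" "(X, F X) \<in> L" for X
      using x that tangent[of x X] by (force simp: mem_vertical_line mem_T)
    have "L \<inter> graph_on {0..1} F = {(x, F x)}"
    proof (intro equalityI subsetI)
      fix z assume "z \<in> L \<inter> graph_on {0..1} F"
      then obtain X where "X \<in> {0..1}" "z = (X, F X)" "(X, F X) \<in> L"
        unfolding graph_on_def by blast
      then show "z \<in> {(x, F x)}" using only by blast
    qed (use x(1) \<open>(x, F x) \<in> L\<close> in \<open>simp add: graph_on_def\<close>)
    then show "\<exists>p. L \<inter> graph_on {0..1} F = {p}" ..
  qed
  moreover have "hausdorff_dim (\<Union>E) = 1"
  proof -
    (* A reference point whose slope is close to s; for s without such a point the value is irrelevant,
       since then no tangent is assigned to s. *)
    define w where "w n s = (SOME w. w \<in> {0..1} \<and> \<bar>g w - s\<bar> < \<rho> n)" for n s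
    have w: "w n s \<in> {0..1}" "\<bar>g (w n s) - s\<bar> < \<rho> n" if "x \<in> {0..1}" "\<bar>g x - s\<bar> < \<rho> n" for n s x
      using someI[of "\<lambda>w. w \<in> {0..1} \<and> \<bar>g w - s\<bar> < \<rho> n" x] that unfolding w_def by auto
    define Q :: "nat \<Rightarrow> ((real \<times> real) \<times> (real \<times> real)) set" where "Q n = (\<lambda>p. ((p, 0), (0, 1))) ` P n \<union>
        (\<lambda>s. ((0, F (w n s) - g (w n s) * w n s), (1, g (w n s)))) ` S n" for n
    define q where "q n = c n * \<rho> n" for n
    have q: "0 < q n" "q n \<le> 1 / (real n + 1)" "q n \<le> \<tau> n (card (P n) + card (S n))" for n
      using \<rho>[of n] c[of n] by (auto simp: q_def le_divide_eq mult.commute)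
    have norm_le: "norm (1::real, g x) \<le> 2" for x
      using norm_Pair_le[of "1::real" "g x"] g(3,4)[of x] by simp
    have null: "hausdorff_measure s (\<Union>E) = 0" if s: "1 < s" for s
    proof (rule hausdorff_measure_tubes_eq_0[OF s, where Q = Q and q = q])
      fix n
      have "card (Q n) \<le> card (P n) + card (S n)"
        unfolding Q_def by (rule order_trans[OF card_Un_le add_mono]) (auto intro: card_image_le PS)
      then have "card (Q n) * q n powr (1 / (real n + 1))
          \<le> (card (P n) + card (S n)) * q n powr (1 / (real n + 1))"
        by (intro mult_right_mono) auto
      also have "\<dots> \<le> (1/2) ^ n / (12 * (real n + 1))"
        using \<tau>(2)[OF q(1,3)] .
      finally show "card (Q n) * q n powr (1 / (real n + 1)) \<le> (1/2) ^ n / (12 * (real n + 1))" .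
    next
      fix z assume "z \<in> \<Union>E"
      obtain X Y where z: "z = (X, Y)" by (cases z)
      have ev: "\<forall>\<^sub>F n in sequentially. \<bar>a\<bar> \<le> real n" for a :: real
        using eventually_ge_at_top[of "nat \<lceil>\<bar>a\<bar>\<rceil>"] by eventually_elim linarith
      from \<open>z \<in> \<Union>E\<close> consider "X \<in> V" | x where "x \<in> {0..1}" "x \<notin> V" "Y = F x + g x * (X - x)"
        by (auto simp: E_def z mem_vertical_line mem_T)
      then show "\<exists>\<^sub>F n in sequentially.
          \<exists>(a, v)\<in>Q n. \<exists>t. \<bar>t\<bar> \<le> real n \<and> dist z (a + t *\<^sub>R v) \<le> q n / 6"
      proof cases
        case 1
        then have "\<exists>\<^sub>F n in sequentially. \<exists>p\<in>P n. \<bar>X - p\<bar> < \<rho> n" by (simp add: V_def)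
        then show ?thesis
        proof (rule frequently_rev_mp, use ev[of Y] in eventually_elim, intro impI)
          fix n assume "\<bar>Y\<bar> \<le> real n" "\<exists>p\<in>P n. \<bar>X - p\<bar> < \<rho> n"
          then obtain p where p: "p \<in> P n" "\<bar>X - p\<bar> < \<rho> n" by blast
          have "\<rho> n \<le> q n / 6" using \<rho>(1)[of n] by (simp add: q_def c_def)
          then have "dist z ((p, 0) + Y *\<^sub>R (0, 1)) \<le> q n / 6"
            using p by (simp add: z dist_Pair_Pair dist_real_def)
          then show "\<exists>(a, v)\<in>Q n. \<exists>t. \<bar>t\<bar> \<le> real n \<and> dist z (a + t *\<^sub>R v) \<le> q n / 6"
            using p \<open>\<bar>Y\<bar> \<le> real n\<close> by (intro bexI[of _ "((p, 0), (0, 1))"]) (auto simp: Q_def)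
        qed
      next
        case 2
        then have "\<forall>\<^sub>F n in sequentially. \<not> (\<exists>p\<in>P n. \<bar>x - p\<bar> < \<rho> n)"
          by (auto simp: V_def not_frequently)
        then have "\<forall>\<^sub>F n in sequentially. \<exists>(a, v)\<in>Q n. \<exists>t. \<bar>t\<bar> \<le> real n \<and> dist z (a + t *\<^sub>R v) \<le> q n / 6"
          using ev[of X]
        proof eventually_elim
          case (elim n)
          then obtain s where s: "s \<in> S n" "\<bar>g x - s\<bar> < \<rho> n"
            using near[OF 2(1), of n] by blast
          define u where "u = w n s"
          have u: "u \<in> {0..1}" "\<bar>g u - s\<bar> < \<rho> n"
            using w[OF 2(1) s(2)] by (auto simp: u_def)
          have "F x + g x * (u - x) \<le> F u" "F u + g u * (x - u) \<le> F x"
            using tangent[of x u] tangent[of u x] u 2 by (cases "x = u"; force)+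
          then have "\<bar>Y - (F u + g u * (X - u))\<bar> \<le> \<bar>g x - g u\<bar> * (\<bar>X - x\<bar> + \<bar>x - u\<bar>)"
            unfolding 2(3) by (rule tangent_lines_close)
          also have "\<dots> \<le> (2 * \<rho> n) * (real n + 2)"
            using s u 2(1) elim(2) \<rho>(1)[of n] by (intro mult_mono) auto
          also have "\<dots> = q n / 6" by (simp add: q_def c_def)
          finally have "dist z ((0, F u - g u * u) + X *\<^sub>R (1, g u)) \<le> q n / 6"
            by (simp add: z dist_Pair_Pair dist_real_def algebra_simps)
          then show ?case
            using s elim(2) unfolding Q_def u_def by (intro bexI[OF _ UnI2[OF imageI]]) auto
        qed
        then show ?thesis by (intro eventually_frequently) auto
      qed
    qed (use norm_le PS q in \<open>auto simp: Q_def\<close>)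
    have "0 \<in> V \<or> T 0 \<in> E" by (auto simp: E_def)
    then have "range (\<lambda>t. (0, 0) + t *\<^sub>R (0, 1)) \<subseteq> \<Union>E \<or>
        range (\<lambda>t. (0, F 0 - g 0 * 0) + t *\<^sub>R (1, g 0)) \<subseteq> \<Union>E"
      unfolding E_def T_def vertical_line_def line_with_slope_def fst_conv snd_conv by blast
    moreover have "1 \<le> norm (1::real, g 0)"
      using norm_fst_le[of "1::real" "g 0"] by simp
    ultimately show ?thesis
      using null hausdorff_dim_eq_1I[of "(1, g 0)" "(0, F 0 - g 0 * 0)" "\<Union>E"]
        hausdorff_dim_eq_1I[of "(0, 1)" "(0, 0)" "\<Union>E"] by auto
  qed
  ultimately show ?thesis by blast
qed

end
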